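(* Let $\lambda>0$, $0<\varphi<\pi$, $2\varphi-2\pi<t<2\varphi$ and $n\in\mathbb{N}$. Then for all $x$, $$P_n^{(\lambda)}\bigl(x;\varphi-\tfrac12t\bigr)=\sum_{k=0}^n\frac{i^ke^{-ik\varphi}}{k!}(\lambda+ix)_k\,P^{(\lambda+\frac12k)}_{n-k}\bigl(x-\tfrac k2i;\varphi\bigr)\bigl(2\sin(\tfrac12t)\bigr)^ke^{-\frac12t(n-k)i}.$$
   Context: $\mathbb N=\{0,1,2,\dots\}$, $i=\sqrt{-1}$, $(y)_k=y(y+1)\cdots(y+k-1)$. The Meixner–Pollaczek polynomials are $$P_n^{(\lambda)}(x;\varphi)=\frac{(2\lambda)_n}{n!}e^{in\varphi}\sum_{j=0}^n\frac{(-n)_j(\lambda+ix)_j}{(2\lambda)_j\,j!}\bigl(1-e^{-2i\varphi}\bigr)^j,$$ polynomials in $x$, which may be evaluated at complex arguments. *)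

theory Defs
  imports Complex_Main
begin

text \<open>The argument \<open>x\<close> is complex, since the polynomials are also evaluated off the real line.\<close>

definition meixner_pollaczek :: "nat \<Rightarrow> real \<Rightarrow> complex \<Rightarrow> real \<Rightarrow> complex" where
  "meixner_pollaczek n lam x \<phi> =
     complex_of_real (pochhammer (2 * lam) n / fact n) * exp (\<i> * of_nat n * of_real \<phi>) *
     (\<Sum>j=0..n. pochhammer (- of_nat n) j * pochhammer (of_real lam + \<i> * x) j
                 / (of_real (pochhammer (2 * lam) j) * fact j)
               * (1 - exp (- 2 * \<i> * of_real \<phi>)) ^ j)"

end

theory Submission
  imports Defs
begin

text \<open>
  Both sides are one Taylor expansion. Once the quotient of \<open>(2\<lambda>)\<^sub>n\<close> by \<open>(2\<lambda>)\<^sub>j\<close> is cancelled,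
  the Meixner-Pollaczek polynomial is \<open>e\<^sup>i\<^sup>n\<^sup>\<phi>\<close> times a polynomial of degree \<open>n\<close> in the variable
  \<open>v = e\<^sup>-\<^sup>2\<^sup>i\<^sup>\<phi> - 1\<close>, with parameters \<open>c = 2\<lambda>\<close> and \<open>a = \<lambda> + ix\<close>. Differentiating this
  polynomial \<open>k\<close> times in \<open>v\<close> reproduces the same family up to the factor \<open>(a)\<^sub>k\<close>, with \<open>n\<close>
  lowered and \<open>a\<close> and \<open>c\<close> raised by \<open>k\<close>; Taylor's formula is \<open>mp_poly_add\<close>. The shift
  \<open>\<lambda> \<mapsto> \<lambda> + k/2\<close>, \<open>x \<mapsto> x - ki/2\<close> in the theorem is exactly \<open>c \<mapsto> c + k\<close>, \<open>a \<mapsto> a + k\<close>. Finally,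
  replacing \<open>\<phi>\<close> by \<open>\<phi> - t/2\<close> adds to \<open>v\<close> the increment
  \<open>e\<^sup>-\<^sup>2\<^sup>i\<^sup>\<phi> (e\<^sup>i\<^sup>t - 1) = 2i sin (t/2) e\<^sup>-\<^sup>i\<^sup>\<phi> e\<^sup>-\<^sup>i\<^sup>(\<^sup>\<phi>\<^sup>-\<^sup>t\<^sup>/\<^sup>2\<^sup>)\<close>, whose \<open>k\<close>-th power, multiplied by
  the prefactor \<open>e\<^sup>i\<^sup>n\<^sup>(\<^sup>\<phi>\<^sup>-\<^sup>t\<^sup>/\<^sup>2\<^sup>)\<close> of the left-hand side, yields the powers and exponentials in the
  \<open>k\<close>-th summand together with the prefactor \<open>e\<^sup>i\<^sup>(\<^sup>n\<^sup>-\<^sup>k\<^sup>)\<^sup>\<phi>\<close> of the polynomial there.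
\<close>

text \<open>
  The polynomial \<open>(c)\<^sub>n / n! * \<^sub>2F\<^sub>1(-n, a; c; -v)\<close>, with the denominators \<open>(c)\<^sub>j\<close> cancelled so that
  it makes sense for every \<open>c\<close>.
\<close>
definition mp_poly :: "nat \<Rightarrow> 'a \<Rightarrow> 'a \<Rightarrow> 'a \<Rightarrow> 'a :: field_char_0" where
  "mp_poly n c a v =
     (\<Sum>j\<le>n. pochhammer (c + of_nat j) (n - j) / fact (n - j) * (pochhammer a j / fact j) * v ^ j)"

text \<open>
  Taylor's formula in \<open>v\<close>. The binomial theorem turns \<open>(v + u)\<^sup>m / m!\<close> into a convolution of
  \<open>u\<^sup>k / k!\<close> and \<open>v\<^sup>j / j!\<close>, and \<open>(a)\<^sub>k\<^sub>+\<^sub>j = (a)\<^sub>k (a + k)\<^sub>j\<close> distributes the remaining factor.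
\<close>
lemma mp_poly_add:
  fixes c a v u :: "'a :: field_char_0"
  shows "mp_poly n c a (v + u) =
    (\<Sum>k\<le>n. u ^ k / fact k * pochhammer a k * mp_poly (n - k) (c + of_nat k) (a + of_nat k) v)"
proof -
  define g where "g k j = pochhammer (c + of_nat (k + j)) (n - (k + j)) / fact (n - (k + j))
      * pochhammer a (k + j) * (u ^ k / fact k) * (v ^ j / fact j)" for k j
  have "mp_poly n c a (v + u) = (\<Sum>m\<le>n. \<Sum>k\<le>m. g k (m - k))"
    unfolding mp_poly_def
  proof (rule sum.cong[OF refl])
    fix m assume "m \<in> {..n}"
    have "(v + u) ^ m / fact m = (\<Sum>k\<le>m. (u ^ k / fact k) * (v ^ (m - k) / fact (m - k)))"
      unfolding add.commute[of v u] binomial_ring sum_divide_distrib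
      by (intro sum.cong refl) (simp add: binomial_fact)
    then have "pochhammer (c + of_nat m) (n - m) / fact (n - m) * (pochhammer a m / fact m) * (v + u) ^ m
        = pochhammer (c + of_nat m) (n - m) / fact (n - m) * pochhammer a m
          * (\<Sum>k\<le>m. (u ^ k / fact k) * (v ^ (m - k) / fact (m - k)))"
      by (metis (no_types, lifting) mult.assoc times_divide_eq_left times_divide_eq_right)
    also have "\<dots> = (\<Sum>k\<le>m. g k (m - k))"
      unfolding sum_distrib_left g_def by (intro sum.cong refl) (simp add: mult.assoc)
    finally show "pochhammer (c + of_nat m) (n - m) / fact (n - m) * (pochhammer a m / fact m) * (v + u) ^ m
        = (\<Sum>k\<le>m. g k (m - k))" .
  qed
  also have "\<dots> = (\<Sum>(k, j)\<in>{(k, j). k + j \<le> n}. g k j)"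
    by (rule sum.triangle_reindex_eq[symmetric])
  also have "{(k, j). k + j \<le> n} = Sigma {..n} (\<lambda>k. {..n - k})"
    by auto
  also have "(\<Sum>(k, j)\<in>Sigma {..n} (\<lambda>k. {..n - k}). g k j) = (\<Sum>k\<le>n. \<Sum>j\<le>n - k. g k j)"
    by (rule sum.Sigma[symmetric]) auto
  also have "\<dots> = (\<Sum>k\<le>n. u ^ k / fact k * pochhammer a k
      * mp_poly (n - k) (c + of_nat k) (a + of_nat k) v)"
    unfolding mp_poly_def sum_distrib_left g_def
    by (intro sum.cong refl) (simp add: pochhammer_product' add.assoc mult_ac)
  finally show ?thesis .
qed

text \<open>
  Positivity of \<open>\<lambda>\<close> makes \<open>(2\<lambda>)\<^sub>j\<close> nonzero, so that \<open>(2\<lambda>)\<^sub>n / (2\<lambda>)\<^sub>j = (2\<lambda> + j)\<^sub>n\<^sub>-\<^sub>j\<close>; moreover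
  \<open>(-n)\<^sub>j / n! = (-1)\<^sup>j / (n - j)!\<close>, whose sign is absorbed by the choice of variable
  \<open>e\<^sup>-\<^sup>2\<^sup>i\<^sup>\<phi> - 1\<close> instead of \<open>1 - e\<^sup>-\<^sup>2\<^sup>i\<^sup>\<phi>\<close>.
\<close>
lemma meixner_pollaczek_eq_mp_poly:
  assumes "lam > 0"
  shows "meixner_pollaczek n lam x \<phi> = exp (\<i> * of_nat n * of_real \<phi>)
    * mp_poly n (of_real (2 * lam)) (of_real lam + \<i> * x) (exp (- 2 * \<i> * of_real \<phi>) - 1)"
proof -
  define c where "c = complex_of_real (2 * lam)"
  define a where "a = of_real lam + \<i> * x"
  define w where "w = 1 - exp (- 2 * \<i> * complex_of_real \<phi>)"
  have summand: "pochhammer c n / fact n * (pochhammer (- of_nat n) j * pochhammer a j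
          / (pochhammer c j * fact j) * w ^ j)
      = pochhammer (c + of_nat j) (n - j) / fact (n - j) * (pochhammer a j / fact j) * (- w) ^ j"
    if "j \<le> n" for j
  proof -
    have "pochhammer (2 * lam) j \<noteq> 0"
      using pochhammer_pos[of "2 * lam" j] assms by simp
    then have nz: "pochhammer c j \<noteq> 0"
      unfolding c_def pochhammer_of_real by simp
    have prod: "pochhammer c n = pochhammer c j * pochhammer (c + of_nat j) (n - j)"
      using that by (rule pochhammer_product)
    have "pochhammer (- of_nat n) j = (- 1) ^ j * (of_nat (n choose j) * fact j :: complex)"
      by (simp add: pochhammer_minus binomial_gbinomial gbinomial_pochhammer')
    also have "of_nat (n choose j) * fact j = (fact n / fact (n - j) :: complex)"
      using that by (simp add: binomial_fact)
    finally have neg: "pochhammer (- of_nat n) j = (- 1) ^ j * (fact n / fact (n - j) :: complex)" .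
    show ?thesis
      unfolding prod neg power_minus[of w] using nz by (simp add: field_simps)
  qed
  have "mp_poly n c a (- w) = pochhammer c n / fact n * (\<Sum>j=0..n. pochhammer (- of_nat n) j
          * pochhammer a j / (pochhammer c j * fact j) * w ^ j)"
    unfolding mp_poly_def atLeast0AtMost sum_distrib_left
    by (intro sum.cong refl summand[symmetric]) simp
  moreover have "complex_of_real (pochhammer (2 * lam) j) = pochhammer c j" for j
    unfolding c_def pochhammer_of_real ..
  moreover have "exp (- 2 * \<i> * of_real \<phi>) - 1 = - w"
    by (simp add: w_def)
  ultimately show ?thesis
    unfolding meixner_pollaczek_def c_def[symmetric] a_def[symmetric] w_def[symmetric]
    by (simp add: mult_ac)
qed

theorem mainTheorem20:
  fixes lam \<phi> t :: real and n :: nat and x :: complex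
  assumes "lam > 0" and "0 < \<phi>" and "\<phi> < pi"
    and "2 * \<phi> - 2 * pi < t" and "t < 2 * \<phi>"
  shows "meixner_pollaczek n lam x (\<phi> - t / 2) =
    (\<Sum>k=0..n. \<i> ^ k * exp (- (\<i> * of_nat k * of_real \<phi>)) / fact k
        * pochhammer (of_real lam + \<i> * x) k
        * meixner_pollaczek (n - k) (lam + real k / 2) (x - of_nat k / 2 * \<i>) \<phi>
        * of_real (2 * sin (t / 2)) ^ k
        * exp (- (of_real (t / 2) * of_nat (n - k) * \<i>)))"
proof -
  define a where "a = of_real lam + \<i> * x"
  define c where "c = complex_of_real (2 * lam)"
  define v where "v = exp (- 2 * \<i> * complex_of_real \<phi>) - 1"
  define p where "p = exp (- (\<i> * complex_of_real \<phi>))"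
  define s where "s = complex_of_real (2 * sin (t / 2))"
  define E where "E = exp (\<i> * complex_of_real (\<phi> - t / 2))"
  define u where "u = \<i> * p * s / E"
  have "\<i> * s = exp (\<i> * of_real (t / 2)) - exp (- (\<i> * of_real (t / 2)))"
    unfolding s_def cis_conv_exp[symmetric] by (simp add: complex_eq_iff cis_conv_exp[symmetric] exp_minus cis_inverse del: of_real_divide)
  moreover have "u = p * (\<i> * s) * exp (- (\<i> * complex_of_real (\<phi> - t / 2)))"
    by (simp add: u_def E_def exp_minus field_simps)
  ultimately have "u = exp (- 2 * \<i> * complex_of_real (\<phi> - t / 2)) - exp (- 2 * \<i> * complex_of_real \<phi>)"
    by (simp add: p_def left_diff_distrib right_diff_distrib exp_add[symmetric])
       (simp add: algebra_simps)
  then have shifted: "exp (- 2 * \<i> * complex_of_real (\<phi> - t / 2)) - 1 = v + u"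
    by (simp add: v_def)
  have E_pow: "exp (\<i> * of_nat m * complex_of_real (\<phi> - t / 2)) = E ^ m" for m
    unfolding E_def exp_of_nat_mult[symmetric] by (simp add: mult_ac)
  have p_pow: "exp (- (\<i> * of_nat k * complex_of_real \<phi>)) = p ^ k" for k
    unfolding p_def exp_of_nat_mult[symmetric] by (simp add: mult_ac)
  have summand: "E ^ n * (u ^ k / fact k * pochhammer a k * mp_poly (n - k) (c + of_nat k) (a + of_nat k) v)
      = \<i> ^ k * p ^ k / fact k * pochhammer a k
        * meixner_pollaczek (n - k) (lam + real k / 2) (x - of_nat k / 2 * \<i>) \<phi>
        * s ^ k * exp (- (of_real (t / 2) * of_nat (n - k) * \<i>))"
    if "k \<le> n" for k
  proof -
    have "complex_of_real (2 * (lam + real k / 2)) = c + of_nat k"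
      by (simp add: c_def)
    moreover have "of_real (lam + real k / 2) + \<i> * (x - of_nat k / 2 * \<i>) = a + of_nat k"
      by (simp add: a_def algebra_simps)
    ultimately have mp: "meixner_pollaczek (n - k) (lam + real k / 2) (x - of_nat k / 2 * \<i>) \<phi>
        = exp (\<i> * of_nat (n - k) * of_real \<phi>) * mp_poly (n - k) (c + of_nat k) (a + of_nat k) v"
      using meixner_pollaczek_eq_mp_poly[of "lam + real k / 2"] assms(1) by (simp add: v_def)
    have "exp (\<i> * of_nat (n - k) * complex_of_real \<phi>) * exp (- (of_real (t / 2) * of_nat (n - k) * \<i>))
        = E ^ (n - k)"
      unfolding E_pow[symmetric] exp_add[symmetric] by (simp add: algebra_simps)
    moreover have "E ^ n * u ^ k = \<i> ^ k * p ^ k * s ^ k * E ^ (n - k)"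
      using that by (simp add: u_def power_divide power_mult_distrib power_diff E_def)
    ultimately have "E ^ n * u ^ k = \<i> ^ k * p ^ k * s ^ k * (exp (\<i> * of_nat (n - k) * complex_of_real \<phi>)
        * exp (- (of_real (t / 2) * of_nat (n - k) * \<i>)))"
      by simp
    then show ?thesis
      unfolding mp by (simp add: mult_ac)
  qed
  have "meixner_pollaczek n lam x (\<phi> - t / 2) = E ^ n * mp_poly n c a (v + u)"
    unfolding meixner_pollaczek_eq_mp_poly[OF assms(1)] c_def a_def shifted[symmetric] E_pow ..
  also have "\<dots> = (\<Sum>k=0..n. E ^ n
      * (u ^ k / fact k * pochhammer a k * mp_poly (n - k) (c + of_nat k) (a + of_nat k) v))"
    by (simp add: mp_poly_add sum_distrib_left atLeast0AtMost)
  also have "\<dots> = (\<Sum>k=0..n. \<i> ^ k * p ^ k / fact k * pochhammer a k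
        * meixner_pollaczek (n - k) (lam + real k / 2) (x - of_nat k / 2 * \<i>) \<phi>
        * s ^ k * exp (- (of_real (t / 2) * of_nat (n - k) * \<i>)))"
    by (intro sum.cong refl summand) simp
  finally show ?thesis
    unfolding p_pow a_def s_def .
qed

end
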